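(* Fix a layer $\ell$, a minibatch of $B\ge 1$ labeled images with two views each, and a temperature $\tau>0$. Let $m_\ell\ge 0$ be a fixed scalar that is not a function of the model parameters $\theta$. Let $\log p_{uv,\ell}$ ($u,v\in\{1,\dots,2B\}$, $v\ne u$) be the log-probabilities computed from the unmodified similarities $s_{uv,\ell}$, in either stability mode (\texttt{detach} or \texttt{direct}), and set $$\log\tilde p_{uv,\ell}=\log p_{uv,\ell}-m_\ell\,M_{uv}.$$ Consider the mean-over-positives loss $$\mathcal L_\ell=-\frac1{2B}\sum_{u=1}^{2B}\frac1{|\mathcal P_u|}\sum_{v\in\mathcal P_u}\log p_{uv,\ell},$$ and let $\tilde{\mathcal L}_\ell$ be the loss obtained from it by replacing each $\log p_{uv,\ell}$ with $\log\tilde p_{uv,\ell}$. Then, as functions of $\theta$: (i) for every anchor $u\in\{1,\dots,2B\}$, the per-anchor term is shifted by the constant $m_\ell$: $$-\frac1{|\mathcal P_u|}\sum_{v\in\mathcal P_u}\log\tilde p_{uv,\ell}=-\frac1{|\mathcal P_u|}\sum_{v\in\mathcal P_u}\log p_{uv,\ell}+m_\ell;$$ (ii) all gradients with respect to model parameters are unchanged: $\nabla_\theta\tilde{\mathcal L}_\ell=\nabla_\theta\mathcal L_\ell$ (at every $\theta$ where the gradient of $\mathcal L_\ell$ is defined).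
   Context: Setting: supervised contrastive loss at one layer $\ell$ of a network with real parameters $\theta$. A minibatch consists of $B$ images with class labels in $\{1,\dots,K\}$, and each image has two augmented views. The $2B$ views are indexed by $u\in\{1,\dots,2B\}$: indices $1,\dots,B$ are the first views and $B+1,\dots,2B$ the second views of images $1,\dots,B$. The label $y(u)$ is that of the underlying image. The minibatch, the views and the labels are fixed and do not depend on $\theta$. Representations: $z_{u,\ell}=z_{u,\ell}(\theta)\in\mathbb R^d$ is a unit vector (the $\ell_2$-normalized mean over tokens of the layer's output on view $u$). Similarities: $s_{uv,\ell}=z_{u,\ell}^\top z_{v,\ell}\in[-1,1]$. Positive mask and positive set: $M_{uv}=1$ if $y(u)=y(v)$ and $u\ne v$, and $M_{uv}=0$ otherwise. $\mathcal P_u=\{v: M_{uv}=1\}$. This set is never empty, since it contains the other view of the same image. Logits (from unmodified similarities): $b_{uv,\ell}=s_{uv,\ell}/\tau$. Stability shift: let $\alpha_{u,\ell}=\max_{k\ne u}b_{uk,\ell}$. In \texttt{direct} mode $g_{uv,\ell}=b_{uv,\ell}-\alpha_{u,\ell}$. In \texttt{detach} mode $g_{uv,\ell}=b_{uv,\ell}-\mathrm{sg}(\alpha_{u,\ell})$, where the stop-gradient $\mathrm{sg}(x)$ has the same value as $x$ but is treated as a constant (zero derivative) when differentiating. Both modes give the same values of $g_{uv,\ell}$. Log-probabilities: for $v\ne u$, $\log p_{uv,\ell}=g_{uv,\ell}-\log\bigl(\sum_{k\ne u}\exp(g_{uk,\ell})\bigr)$. The symbol $\log\tilde p_{uv,\ell}$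 is just notation for the quantity defined in the claim. *)

theory Defs
  imports "HOL-Analysis.Analysis"
begin

text \<open>
  The minibatch has images \<open>1, \<dots>, B\<close> with labels \<open>c 1, \<dots>, c B\<close>; the views are
  \<open>1, \<dots>, 2 * B\<close>, where \<open>i\<close> and \<open>B + i\<close> are the two views of image \<open>i\<close>.
\<close>

definition view_label :: "nat \<Rightarrow> (nat \<Rightarrow> nat) \<Rightarrow> nat \<Rightarrow> nat" where
  "view_label B c u = (if u \<le> B then c u else c (u - B))"

definition pos_mask :: "nat \<Rightarrow> (nat \<Rightarrow> nat) \<Rightarrow> nat \<Rightarrow> nat \<Rightarrow> real" where
  "pos_mask B c u v = (if view_label B c u = view_label B c v \<and> u \<noteq> v then 1 else 0)"

definition pos_set :: "nat \<Rightarrow> (nat \<Rightarrow> nat) \<Rightarrow> nat \<Rightarrow> nat set" where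
  "pos_set B c u = {v \<in> {1..2 * B}. pos_mask B c u v = 1}"

text \<open>
  A stop-gradient is not an operation on functions of the parameter \<open>\<theta>\<close>, since it preserves
  values but not derivatives. A real quantity depending on \<open>\<theta>\<close> is therefore represented by
  \<open>e :: 'p \<Rightarrow> 'p \<Rightarrow> real\<close>, where \<open>e \<theta>\<^sub>0 \<theta>\<close> is its value at \<open>\<theta>\<close> when everything
  under a stop-gradient is held at its value at \<open>\<theta>\<^sub>0\<close>. The value of the quantity at \<open>\<theta>\<close>
  is \<open>e \<theta> \<theta>\<close>; its gradient at \<open>\<theta>\<close> is that of \<open>e \<theta>\<close> at \<open>\<theta>\<close>. For a quantity
  containing no stop-gradient, \<open>e\<close> ignores its first argument, so this is the usual gradient.
\<close>

type_synonym 'p quantity = "'p \<Rightarrow> 'p \<Rightarrow> real"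

definition stop_grad :: "'p quantity \<Rightarrow> 'p quantity" where
  "stop_grad e = (\<lambda>\<theta>\<^sub>0 \<theta>. e \<theta>\<^sub>0 \<theta>\<^sub>0)"

definition has_gradient :: "('p::real_inner) quantity \<Rightarrow> 'p \<Rightarrow> 'p \<Rightarrow> bool" where
  "has_gradient e \<theta> G \<longleftrightarrow> (GDERIV (e \<theta>) \<theta> :> G)"

text \<open>\<open>z u \<theta>\<close> is the representation of view \<open>u\<close> at the layer under consideration.\<close>

definition similarity :: "(nat \<Rightarrow> 'p \<Rightarrow> 'd::real_inner) \<Rightarrow> nat \<Rightarrow> nat \<Rightarrow> 'p quantity" where
  "similarity z u v = (\<lambda>\<theta>\<^sub>0 \<theta>. z u \<theta> \<bullet> z v \<theta>)"

definition logit :: "real \<Rightarrow> (nat \<Rightarrow> 'p \<Rightarrow> 'd::real_inner) \<Rightarrow> nat \<Rightarrow> nat \<Rightarrow> 'p quantity" where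
  "logit \<tau> z u v = (\<lambda>\<theta>\<^sub>0 \<theta>. similarity z u v \<theta>\<^sub>0 \<theta> / \<tau>)"

definition max_logit :: "nat \<Rightarrow> real \<Rightarrow> (nat \<Rightarrow> 'p \<Rightarrow> 'd::real_inner) \<Rightarrow> nat \<Rightarrow> 'p quantity" where
  "max_logit B \<tau> z u = (\<lambda>\<theta>\<^sub>0 \<theta>. Max ((\<lambda>k. logit \<tau> z u k \<theta>\<^sub>0 \<theta>) ` ({1..2 * B} - {u})))"

datatype stability_mode = Direct | Detach

definition shifted_logit ::
  "stability_mode \<Rightarrow> nat \<Rightarrow> real \<Rightarrow> (nat \<Rightarrow> 'p \<Rightarrow> 'd::real_inner) \<Rightarrow> nat \<Rightarrow> nat \<Rightarrow> 'p quantity" where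
  "shifted_logit mode B \<tau> z u v = (\<lambda>\<theta>\<^sub>0 \<theta>. logit \<tau> z u v \<theta>\<^sub>0 \<theta> -
     (case mode of
        Direct \<Rightarrow> max_logit B \<tau> z u \<theta>\<^sub>0 \<theta>
      | Detach \<Rightarrow> stop_grad (max_logit B \<tau> z u) \<theta>\<^sub>0 \<theta>))"

definition log_prob ::
  "stability_mode \<Rightarrow> nat \<Rightarrow> real \<Rightarrow> (nat \<Rightarrow> 'p \<Rightarrow> 'd::real_inner) \<Rightarrow> nat \<Rightarrow> nat \<Rightarrow> 'p quantity" where
  "log_prob mode B \<tau> z u v = (\<lambda>\<theta>\<^sub>0 \<theta>. shifted_logit mode B \<tau> z u v \<theta>\<^sub>0 \<theta> -
     ln (\<Sum>k \<in> {1..2 * B} - {u}. exp (shifted_logit mode B \<tau> z u k \<theta>\<^sub>0 \<theta>)))"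

definition margin_log_prob ::
  "real \<Rightarrow> stability_mode \<Rightarrow> nat \<Rightarrow> (nat \<Rightarrow> nat) \<Rightarrow> real \<Rightarrow> (nat \<Rightarrow> 'p \<Rightarrow> 'd::real_inner)
     \<Rightarrow> nat \<Rightarrow> nat \<Rightarrow> 'p quantity" where
  "margin_log_prob m mode B c \<tau> z u v =
     (\<lambda>\<theta>\<^sub>0 \<theta>. log_prob mode B \<tau> z u v \<theta>\<^sub>0 \<theta> - m * pos_mask B c u v)"

text \<open>The mean-over-positives loss, as a function of the log-probabilities \<open>lp u v\<close>.\<close>

definition anchor_term :: "nat \<Rightarrow> (nat \<Rightarrow> nat) \<Rightarrow> (nat \<Rightarrow> nat \<Rightarrow> 'p quantity) \<Rightarrow> nat \<Rightarrow> 'p quantity" where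
  "anchor_term B c lp u = (\<lambda>\<theta>\<^sub>0 \<theta>.
     - (1 / real (card (pos_set B c u))) * (\<Sum>v \<in> pos_set B c u. lp u v \<theta>\<^sub>0 \<theta>))"

definition mean_pos_loss :: "nat \<Rightarrow> (nat \<Rightarrow> nat) \<Rightarrow> (nat \<Rightarrow> nat \<Rightarrow> 'p quantity) \<Rightarrow> 'p quantity" where
  "mean_pos_loss B c lp = (\<lambda>\<theta>\<^sub>0 \<theta>. - (1 / (2 * real B)) *
     (\<Sum>u = 1..2 * B. (1 / real (card (pos_set B c u))) * (\<Sum>v \<in> pos_set B c u. lp u v \<theta>\<^sub>0 \<theta>)))"

end

theory Submission
  imports Defs
begin

text \<open>The mask equals 1 at every pair the loss reads, so the margin subtracts the same
  \<open>m\<close> from each averaged log-probability. The mean over a nonempty positive set, and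
  then over the anchors, moves by exactly \<open>m\<close> (\<open>anchor_term_margin\<close>,
  \<open>mean_pos_loss_margin\<close>), and a constant has zero derivative
  (\<open>has_gradient_add_const\<close>). The log-probabilities stay opaque, so both stability
  modes are covered at once.\<close>

lemma pos_set_nonempty:
  assumes "u \<in> {1..2 * B}"
  shows "pos_set B c u \<noteq> {}"
proof -
  \<comment> \<open>The witness is the other view of the same image.\<close>
  define v where "v = (if u \<le> B then u + B else u - B)"
  have "v \<in> pos_set B c u"
    using assms by (auto simp: v_def pos_set_def pos_mask_def view_label_def)
  then show ?thesis
    by blast
qed

lemma finite_pos_set [simp]: "finite (pos_set B c u)"
  by (simp add: pos_set_def)

lemma anchor_term_margin:
  assumes "u \<in> {1..2 * B}"
  shows "anchor_term B c (margin_log_prob m mode B c \<tau> z) u \<theta>\<^sub>0 \<theta> =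
    anchor_term B c (log_prob mode B \<tau> z) u \<theta>\<^sub>0 \<theta> + m"
proof -
  let ?P = "pos_set B c u"
  have "(\<Sum>v\<in>?P. margin_log_prob m mode B c \<tau> z u v \<theta>\<^sub>0 \<theta>) =
      (\<Sum>v\<in>?P. log_prob mode B \<tau> z u v \<theta>\<^sub>0 \<theta> - m)"
    by (intro sum.cong) (auto simp: margin_log_prob_def pos_set_def)
  \<comment> \<open>This makes the mean of the constant \<open>m\<close> equal to \<open>m\<close>;
    with an empty set, \<open>1 / 0 = 0\<close> would lose the shift.\<close>
  moreover have "card ?P \<noteq> 0"
    using pos_set_nonempty[OF assms] by simp
  ultimately show ?thesis
    by (simp add: anchor_term_def sum_subtractf field_simps)
qed

text \<open>Moving the sign inside the outer sum lets the anchorwise shift be averaged over the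
  \<open>2 * B\<close> views.\<close>

lemma mean_pos_loss_eq_mean_anchor_term:
  "mean_pos_loss B c lp \<theta>\<^sub>0 \<theta> = (\<Sum>u = 1..2 * B. anchor_term B c lp u \<theta>\<^sub>0 \<theta>) / (2 * real B)"
  by (simp add: mean_pos_loss_def anchor_term_def sum_negf)

lemma mean_pos_loss_margin:
  assumes "B \<ge> 1"
  shows "mean_pos_loss B c (margin_log_prob m mode B c \<tau> z) \<theta>\<^sub>0 \<theta> =
    mean_pos_loss B c (log_prob mode B \<tau> z) \<theta>\<^sub>0 \<theta> + m"
  using assms
  by (simp add: mean_pos_loss_eq_mean_anchor_term anchor_term_margin sum.distrib field_simps)

text \<open>The gradient at \<theta> is that of the slice \<open>e \<theta>\<close>, whose
  stop-gradient argument is frozen. Equal shifts of the values on the diagonal would not control it,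
  hence the hypothesis for independent \<open>\<theta>\<^sub>0\<close> and \<theta>.\<close>

lemma has_gradient_add_const:
  assumes "has_gradient e \<theta> G"
    and "\<And>\<theta>\<^sub>0 \<theta>. e' \<theta>\<^sub>0 \<theta> = e \<theta>\<^sub>0 \<theta> + a"
  shows "has_gradient e' \<theta> G"
proof -
  have "e' \<theta> = (\<lambda>x. e \<theta> x + a)"
    using assms(2) by blast
  then show ?thesis
    using assms(1) by (auto simp: has_gradient_def gderiv_def intro!: derivative_eq_intros)
qed

theorem proposition4p1:
  fixes B K :: nat
    and c :: "nat \<Rightarrow> nat"
    and \<tau> m :: real
    and z :: "nat \<Rightarrow> real ^ 'p \<Rightarrow> real ^ 'd"
    and mode :: stability_mode
  assumes "B \<ge> 1"
    and "\<forall>i \<in> {1..B}. c i \<in> {1..K}"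
    and "\<tau> > 0"
    and "m \<ge> 0"
    and "\<forall>u \<in> {1..2 * B}. \<forall>\<theta>. norm (z u \<theta>) = 1"
  shows "(\<forall>u \<in> {1..2 * B}. \<forall>\<theta>\<^sub>0 \<theta>.
            anchor_term B c (margin_log_prob m mode B c \<tau> z) u \<theta>\<^sub>0 \<theta> =
            anchor_term B c (log_prob mode B \<tau> z) u \<theta>\<^sub>0 \<theta> + m)
       \<and> (\<forall>\<theta> G.
            has_gradient (mean_pos_loss B c (log_prob mode B \<tau> z)) \<theta> G \<longrightarrow>
            has_gradient (mean_pos_loss B c (margin_log_prob m mode B c \<tau> z)) \<theta> G)"
proof (intro conjI ballI allI impI)
  fix \<theta> G
  assume "has_gradient (mean_pos_loss B c (log_prob mode B \<tau> z)) \<theta> G"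
  then show "has_gradient (mean_pos_loss B c (margin_log_prob m mode B c \<tau> z)) \<theta> G"
    by (rule has_gradient_add_const) (rule mean_pos_loss_margin[OF \<open>B \<ge> 1\<close>])
qed (rule anchor_term_margin)

end
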